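(* Let $f$ be a non-negative operator convex function on $[0,\infty)$ such that $f(0)=0$. Then for any positive semidefinite matrices $A$ and $B$ (of the same size), $$\operatorname{Tr}\big((A-B)(f(A)-f(B))\big) \ \ge\ \operatorname{Tr}\big(|A-B|\, f(|A-B|)\big).$$
   Context: Matrices are square complex matrices of an arbitrary finite size $n\times n$; positive semidefinite matrices are Hermitian. $\operatorname{Tr}$ is the usual (unnormalized) trace. For a matrix $X$, $|X| = (X^*X)^{1/2}$. For a positive semidefinite matrix $X$ and a function $f:[0,\infty)\to\mathbb{R}$, $f(X)$ is defined by the functional calculus (spectral theorem). For Hermitian matrices, $X \le Y$ means that $Y-X$ is positive semidefinite. A function $f:[0,\infty)\to\mathbb{R}$ is operator convex on $[0,\infty)$ if, for every $n$, all positive semidefinite $n\times n$ matrices $X, Y$ and all $\lambda\in[0,1]$, $f(\lambda X+(1-\lambda)Y)\le \lambda f(X)+(1-\lambda) f(Y)$. *)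

theory Defs
  imports "Jordan_Normal_Form.Schur_Decomposition"
begin

definition hermitian :: "complex mat \<Rightarrow> bool" where
  "hermitian X \<longleftrightarrow> square_mat X \<and> mat_adjoint X = X"

(* The order on complex is the one of HOL-Library.Complex_Order: 0 \<le> z means that z is
   real and non-negative. *)
definition psd :: "complex mat \<Rightarrow> bool" where
  "psd X \<longleftrightarrow> hermitian X \<and> (\<forall>v \<in> carrier_vec (dim_row X). 0 \<le> (X *\<^sub>v v) \<bullet>c v)"

definition loewner_le :: "complex mat \<Rightarrow> complex mat \<Rightarrow> bool" where
  "loewner_le X Y \<longleftrightarrow>
     dim_row X = dim_row Y \<and> hermitian X \<and> hermitian Y \<and> psd (Y - X)"

definition trace :: "complex mat \<Rightarrow> complex" where
  "trace X = (\<Sum>i<dim_row X. X $$ (i, i))"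

definition unitary :: "complex mat \<Rightarrow> bool" where
  "unitary U \<longleftrightarrow> square_mat U \<and>
     mat_adjoint U * U = 1\<^sub>m (dim_row U) \<and> U * mat_adjoint U = 1\<^sub>m (dim_row U)"

(* U diag(d 0, ..., d (n - 1)) U^*, where n is the size of U *)
definition unitary_conj_diag :: "complex mat \<Rightarrow> (nat \<Rightarrow> real) \<Rightarrow> complex mat" where
  "unitary_conj_diag U d =
     U * mat_diag (dim_row U) (\<lambda>i. complex_of_real (d i)) * mat_adjoint U"

(* Functional calculus of a Hermitian matrix: if X = U diag(d) U^* with U unitary and d real,
   then f(X) = U diag(f \<circ> d) U^*. Such a decomposition exists by the spectral theorem, and the
   result does not depend on its choice, see mat_fun_unitary_conj_diag below. *)
definition mat_fun :: "(real \<Rightarrow> real) \<Rightarrow> complex mat \<Rightarrow> complex mat" where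
  "mat_fun f X = (THE Y. \<exists>U d. unitary U \<and>
     X = unitary_conj_diag U d \<and> Y = unitary_conj_diag U (\<lambda>i. f (d i)))"

lemma mat_adjoint_carrier [simp]:
  "A \<in> carrier_mat m n \<Longrightarrow> mat_adjoint A \<in> carrier_mat n m"
  by (auto simp: mat_adjoint_def mat_of_rows_def)

lemma unitary_conj_diag_carrier [simp]:
  "U \<in> carrier_mat n n \<Longrightarrow> unitary_conj_diag U d \<in> carrier_mat n n"
  by (auto simp: unitary_conj_diag_def mat_adjoint_def mat_of_rows_def)

lemma mat_diag_intertwine_iff:
  assumes W: "W \<in> carrier_mat n n"
  shows "W * mat_diag n d = mat_diag n e * W \<longleftrightarrow>
    (\<forall>i<n. \<forall>j<n. W $$ (i, j) * d j = e i * (W $$ (i, j) :: complex))"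
  using W by (auto simp: mat_diag_mult_left[OF W] mat_diag_mult_right[OF W] mat_eq_iff)

lemma unitary_conj_diag_eq_iff:
  assumes U: "unitary U" "U \<in> carrier_mat n n" and V: "unitary V" "V \<in> carrier_mat n n"
  shows "unitary_conj_diag U d = unitary_conj_diag V e \<longleftrightarrow>
    (\<forall>i<n. \<forall>j<n. (mat_adjoint V * U) $$ (i, j) * complex_of_real (d j) =
       complex_of_real (e i) * (mat_adjoint V * U) $$ (i, j))"
proof -
  define U' V' D E where "U' = mat_adjoint U" and "V' = mat_adjoint V"
    and "D = mat_diag n (\<lambda>i. complex_of_real (d i))"
    and "E = mat_diag n (\<lambda>i. complex_of_real (e i))"
  have C: "U \<in> carrier_mat n n" "V \<in> carrier_mat n n" "U' \<in> carrier_mat n n"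
    "V' \<in> carrier_mat n n" "D \<in> carrier_mat n n" "E \<in> carrier_mat n n"
    using U V by (auto simp: U'_def V'_def D_def E_def)
  have inv: "U' * U = 1\<^sub>m n" "U * U' = 1\<^sub>m n" "V' * V = 1\<^sub>m n" "V * V' = 1\<^sub>m n"
    using U V by (auto simp: unitary_def U'_def V'_def)
  have "U * D * U' = V * E * V' \<longleftrightarrow> V' * U * D = E * (V' * U)"
  proof
    assume eq: "U * D * U' = V * E * V'"
    have "V' * U * D = V' * (U * D * (U' * U))"
      using C by (simp add: inv assoc_mult_mat[of _ n n _ n _ n])
    also have "\<dots> = V' * (U * D * U') * U"
      using C by (simp add: assoc_mult_mat[of _ n n _ n _ n])
    also have "\<dots> = (V' * V) * E * (V' * U)"
      unfolding eq using C by (simp add: assoc_mult_mat[of _ n n _ n _ n])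
    finally show "V' * U * D = E * (V' * U)" using C by (simp add: inv)
  next
    assume eq: "V' * U * D = E * (V' * U)"
    have "U * D * U' = (V * V') * (U * D * U')" using C by (simp add: inv)
    also have "\<dots> = V * (V' * U * D) * U'"
      using C by (simp add: assoc_mult_mat[of _ n n _ n _ n])
    also have "\<dots> = V * E * V' * (U * U')"
      unfolding eq using C by (simp add: assoc_mult_mat[of _ n n _ n _ n])
    finally show "U * D * U' = V * E * V'" using C by (simp add: inv)
  qed
  moreover have "V' * U \<in> carrier_mat n n" using C by auto
  ultimately show ?thesis
    using U(2) V(2) unfolding unitary_conj_diag_def
    by (simp add: U'_def[symmetric] V'_def[symmetric] D_def E_def mat_diag_intertwine_iff)
qed

lemma mat_fun_unitary_conj_diag:
  assumes U: "unitary U"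
  shows "mat_fun f (unitary_conj_diag U d) = unitary_conj_diag U (\<lambda>i. f (d i))"
  unfolding mat_fun_def
proof (rule the_equality)
  show "\<exists>V e. unitary V \<and> unitary_conj_diag U d = unitary_conj_diag V e \<and>
      unitary_conj_diag U (\<lambda>i. f (d i)) = unitary_conj_diag V (\<lambda>i. f (e i))"
    using U by blast
next
  fix Y
  assume "\<exists>V e. unitary V \<and> unitary_conj_diag U d = unitary_conj_diag V e \<and>
      Y = unitary_conj_diag V (\<lambda>i. f (e i))"
  then obtain V e where V: "unitary V" and eq: "unitary_conj_diag U d = unitary_conj_diag V e"
    and Y: "Y = unitary_conj_diag V (\<lambda>i. f (e i))" by blast
  define n where "n = dim_row U"
  have Uc: "U \<in> carrier_mat n n" using U by (auto simp: n_def unitary_def)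
  have Vc: "V \<in> carrier_mat n n"
    using V arg_cong[OF eq, of dim_row] by (auto simp: n_def unitary_def unitary_conj_diag_def)
  have "(mat_adjoint V * U) $$ (i, j) * complex_of_real (f (d j)) =
      complex_of_real (f (e i)) * (mat_adjoint V * U) $$ (i, j)" if "i < n" "j < n" for i j
  proof (cases "(mat_adjoint V * U) $$ (i, j) = 0")
    case False
    moreover have "(mat_adjoint V * U) $$ (i, j) * complex_of_real (d j) =
        complex_of_real (e i) * (mat_adjoint V * U) $$ (i, j)"
      using eq that unfolding unitary_conj_diag_eq_iff[OF U Uc V Vc] by blast
    ultimately have "d j = e i" by simp
    then show ?thesis by simp
  qed simp
  then show "Y = unitary_conj_diag U (\<lambda>i. f (d i))"
    unfolding Y
    by (intro unitary_conj_diag_eq_iff[OF U Uc V Vc, THEN iffD2, symmetric] allI impI)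
qed

definition mat_abs :: "complex mat \<Rightarrow> complex mat" where
  "mat_abs X = mat_fun sqrt (mat_adjoint X * X)"

(* A function on [0, \<infinity>) is represented by a function on all reals; only its values on
   [0, \<infinity>) matter, because positive semidefinite matrices have non-negative eigenvalues. *)
definition operator_convex :: "(real \<Rightarrow> real) \<Rightarrow> bool" where
  "operator_convex f \<longleftrightarrow>
     (\<forall>n. \<forall>X \<in> carrier_mat n n. \<forall>Y \<in> carrier_mat n n. \<forall>t \<in> {0..1::real}.
        psd X \<longrightarrow> psd Y \<longrightarrow>
        loewner_le
          (mat_fun f (complex_of_real t \<cdot>\<^sub>m X + complex_of_real (1 - t) \<cdot>\<^sub>m Y))
          (complex_of_real t \<cdot>\<^sub>m mat_fun f X + complex_of_real (1 - t) \<cdot>\<^sub>m mat_fun f Y))"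

end

theory Submission
  imports "HOL-Analysis.Equivalence_Measurable_On_Borel" Defs
begin

text \<open>
Let \<open>P\<close> and \<open>M\<close> be the positive and negative parts of \<open>A - B\<close>, and let \<open>R = B + P = A + M\<close>. Then
\<open>Tr ((A - B)(f(A) - f(B)))\<close> is
\<open>Tr (P (f(R) - f(B))) - Tr (M (f(R) - f(B))) - Tr (P (f(R) - f(A))) + Tr (M (f(R) - f(A)))\<close>,
where \<open>R\<close> arises from \<open>B\<close> by adding \<open>P\<close>, and from \<open>A\<close> by adding \<open>M\<close>. As \<open>P\<close> and \<open>M\<close> commute, \<open>P M = 0\<close>,
\<open>\<bar>A - B\<bar> = P + M\<close> and \<open>f 0 = 0\<close>, the right-hand side of the theorem is \<open>Tr (P f(P)) + Tr (M f(M))\<close>. So two facts about positive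
semidefinite \<open>B\<close>, \<open>C\<close>, \<open>E\<close> suffice:

\<^item> \<open>trace_increment_ge\<close>: \<open>Tr (C (f(B + C) - f(B))) \<ge> Tr (C f(C))\<close>, applied to the first and last term;
\<^item> \<open>trace_orthogonal_perturbation_le\<close>: if \<open>E\<close> and \<open>C\<close> are diagonal in the same basis and \<open>E C = 0\<close>, then
  \<open>Tr (E f(B + C)) \<le> Tr (E f(B))\<close>, applied to the two middle terms.

Operator convexity says that \<open>X \<mapsto> Tr (E f(X))\<close> is convex on the positive semidefinite matrices for every
positive semidefinite \<open>E\<close>; in particular \<open>s \<mapsto> Tr (E f(B + s C))\<close> is convex on \<open>[0, \<infinity>)\<close>. The second fact holds because in its situation this convex
function is also bounded above. The first one is a statement on mixed differences of
\<open>H(u, s) = Tr F(u B + s C)\<close>, where \<open>F\<close> is an antiderivative of \<open>f\<close>: the derivative of \<open>H\<close> in \<open>u\<close> is convex in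
\<open>s\<close>, and the derivative in \<open>s\<close> is \<open>Tr (C f(u B + s C))\<close>. Klein's inequality (\<open>Klein_inequality\<close>) replaces
the differentiation of \<open>H\<close>.
\<close>

section \<open>Adjoints and the spectral theorem\<close>

lemma dim_mat_adjoint [simp]:
  "dim_row (mat_adjoint A) = dim_col A" "dim_col (mat_adjoint A) = dim_row A"
  by (simp_all add: mat_adjoint_def)

lemma mat_adjoint_index [simp]:
  "i < dim_col A \<Longrightarrow> j < dim_row A \<Longrightarrow> mat_adjoint A $$ (i, j) = cnj (A $$ (j, i))"
  by (simp add: mat_adjoint_def mat_of_rows_def)

lemma mat_adjoint_mult:
  assumes "dim_col A = dim_row B"
  shows "mat_adjoint (A * B :: complex mat) = mat_adjoint B * mat_adjoint A"
  using assms by (intro eq_matI) (auto simp: scalar_prod_def intro!: sum.cong)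

lemma mat_adjoint_adjoint [simp]: "mat_adjoint (mat_adjoint A) = (A :: complex mat)"
  by (intro eq_matI) auto

lemma mat_adjoint_add:
  assumes "dim_row A = dim_row B" "dim_col A = dim_col B"
  shows "mat_adjoint (A + B :: complex mat) = mat_adjoint A + mat_adjoint B"
  using assms by (intro eq_matI) auto

lemma mat_adjoint_real_diag [simp]:
  "mat_adjoint (mat_diag n (\<lambda>i. complex_of_real (d i))) = mat_diag n (\<lambda>i. complex_of_real (d i))"
  by (intro eq_matI) (auto simp: mat_diag_def)

lemma cscalar_prod_adjoint:
  assumes "A \<in> carrier_mat m n" "v \<in> carrier_vec n" "w \<in> carrier_vec m"
  shows "(A *\<^sub>v v) \<bullet>c w = v \<bullet>c (mat_adjoint A *\<^sub>v (w :: complex vec))"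
proof -
  have "(A *\<^sub>v v) \<bullet>c w = (\<Sum>i<m. \<Sum>j<n. A $$ (i, j) * v $ j * cnj (w $ i))"
    using assms by (simp add: scalar_prod_def sum_distrib_right atLeast0LessThan)
  also have "\<dots> = (\<Sum>j<n. \<Sum>i<m. A $$ (i, j) * v $ j * cnj (w $ i))"
    by (rule sum.swap)
  also have "\<dots> = v \<bullet>c (mat_adjoint A *\<^sub>v w)"
    using assms
    by (auto simp: scalar_prod_def sum_distrib_left atLeast0LessThan intro!: sum.cong)
  finally show ?thesis .
qed

lemma unitaryI:
  assumes "U \<in> carrier_mat n n" "mat_adjoint U * U = 1\<^sub>m n"
  shows "unitary U"
  using assms mat_mult_left_right_inverse[OF mat_adjoint_carrier[OF assms(1)] assms(1) assms(2)]
  by (auto simp: unitary_def)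

lemma unitary_mult:
  assumes "unitary U" "unitary V" "U \<in> carrier_mat n n" "V \<in> carrier_mat n n"
  shows "unitary (U * V)"
proof (rule unitaryI)
  define U' V' where "U' = mat_adjoint U" and "V' = mat_adjoint V"
  have C: "U \<in> carrier_mat n n" "V \<in> carrier_mat n n" "U' \<in> carrier_mat n n" "V' \<in> carrier_mat n n"
    using assms by (auto simp: U'_def V'_def)
  have inv: "U' * U = 1\<^sub>m n" "V' * V = 1\<^sub>m n"
    using assms by (auto simp: unitary_def U'_def V'_def)
  have "mat_adjoint (U * V) * (U * V) = V' * (U' * U) * V"
    using C by (simp add: mat_adjoint_mult assoc_mult_mat[of _ n n _ n _ n] flip: U'_def V'_def)
  also have "\<dots> = 1\<^sub>m n" using C by (simp add: inv)
  finally show "mat_adjoint (U * V) * (U * V) = 1\<^sub>m n" .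
qed (use assms in auto)

text \<open>Gram-Schmidt applied to a basis that starts with \<open>v\<close>, with the resulting columns normalized.\<close>

lemma exists_unitary_first_column:
  assumes v: "v \<in> carrier_vec n" and v0: "v \<noteq> 0\<^sub>v n"
  shows "\<exists>W c. W \<in> carrier_mat n n \<and> unitary W \<and> col W 0 = c \<cdot>\<^sub>v (v :: complex vec)"
proof -
  interpret cof_vec_space n "TYPE(complex)" .
  have n0: "n \<noteq> 0" using v v0 by (auto intro: eq_vecI)
  define b where "b = basis_completion v"
  define ws where "ws = gram_schmidt n b"
  from basis_completion[OF v v0, folded b_def]
  have dist_b: "distinct b" and indep: "\<not> lin_dep (set b)" and b: "set b \<subseteq> carrier_vec n"
    and hdb: "hd b = v" and len_b: "length b = n" by auto
  from hdb len_b n0 obtain vs where bv: "b = v # vs" by (cases b, auto)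
  from gram_schmidt_result[OF b dist_b indep refl, folded ws_def]
  have ws: "set ws \<subseteq> carrier_vec n" "corthogonal ws" "length ws = n" by (auto simp: len_b)
  from gram_schmidt_hd[OF v, of vs, folded bv] have hdws: "hd ws = v" unfolding ws_def .
  define r where "r i = complex_of_real (1 / sqrt (Re (ws ! i \<bullet>c ws ! i)))" for i
  have r_real: "cnj (r i) = r i" for i by (simp add: r_def)
  define W where "W = mat n n (\<lambda>(i, j). r j * (ws ! j) $ i)"
  have W: "W \<in> carrier_mat n n" by (simp add: W_def)
  have wsc: "ws ! i \<in> carrier_vec n" if "i < n" for i using ws that by auto
  have col: "col W j = r j \<cdot>\<^sub>v ws ! j" if "j < n" for j
    by (rule eq_vecI) (use that wsc[OF that] in \<open>auto simp: W_def\<close>)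
  have "unitary W"
  proof (rule unitaryI[OF W], rule eq_matI)
    fix i j assume "i < dim_row (1\<^sub>m n :: complex mat)" "j < dim_col (1\<^sub>m n :: complex mat)"
    then have ij: "i < n" "j < n" by auto
    have "(mat_adjoint W * W) $$ (i, j) = (\<Sum>k<n. cnj (r i * (ws ! i) $ k) * (r j * (ws ! j) $ k))"
      using ij by (auto simp: scalar_prod_def atLeast0LessThan W_def)
    also have "\<dots> = r i * r j * (ws ! j \<bullet>c ws ! i)"
      using wsc[OF ij(1)] wsc[OF ij(2)]
      by (auto simp: scalar_prod_def sum_distrib_left atLeast0LessThan r_real mult_ac intro!: sum.cong)
    also have "\<dots> = (if i = j then 1 else 0)"
    proof (cases "i = j")
      case True
      have "ws ! i \<bullet>c ws ! i > 0"
        using corthogonalD[OF ws(2), of i i] ij ws(3) conjugate_square_ge_0_vec[of "ws ! i"] wsc[OF ij(1)]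
        by (auto simp: order.strict_iff_order)
      then have "0 < Re (ws ! i \<bullet>c ws ! i)" "ws ! i \<bullet>c ws ! i = complex_of_real (Re (ws ! i \<bullet>c ws ! i))"
        by (auto simp: less_complex_def complex_eq_iff)
      then obtain x where x: "0 < x" "ws ! i \<bullet>c ws ! i = complex_of_real x" by blast
      have "r i * r i * (ws ! i \<bullet>c ws ! i) = complex_of_real (1 / sqrt x * (1 / sqrt x) * x)"
        by (simp add: r_def x(2) del: times_divide_eq_left times_divide_eq_right)
      also have "\<dots> = 1" using x(1) by simp
      finally show ?thesis using True by simp
    next
      case False
      then show ?thesis using corthogonalD[OF ws(2), of j i] ij ws(3) by auto
    qed
    finally show "(mat_adjoint W * W) $$ (i, j) = (1\<^sub>m n :: complex mat) $$ (i, j)" using ij by simp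
  qed (use W mat_adjoint_carrier[OF W] in auto)
  moreover have "col W 0 = r 0 \<cdot>\<^sub>v v"
    using col[of 0] n0 hdws ws(3) by (cases ws) auto
  ultimately show ?thesis using W by blast
qed

lemma exists_eigenvector:
  assumes A: "(A :: complex mat) \<in> carrier_mat n n" and n: "n \<noteq> 0"
  shows "\<exists>v e. v \<in> carrier_vec n \<and> v \<noteq> 0\<^sub>v n \<and> A *\<^sub>v v = e \<cdot>\<^sub>v v"
proof -
  obtain as where as: "char_poly A = (\<Prod>a \<leftarrow> as. [:- a, 1:])" "length as = n"
    using char_poly_factorized[OF A] by blast
  then obtain e es where "as = e # es" using n by (cases as) auto
  then have "eigenvalue A e" using as unfolding eigenvalue_root_char_poly[OF A] by simp
  then show ?thesis using A by (auto simp: eigenvalue_def eigenvector_def)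
qed

lemma block_diag_mult:
  assumes "X \<in> carrier_mat p p" "X' \<in> carrier_mat p p" "Y \<in> carrier_mat m m" "Y' \<in> carrier_mat m m"
  shows "four_block_mat X (0\<^sub>m p m) (0\<^sub>m m p) Y * four_block_mat X' (0\<^sub>m p m) (0\<^sub>m m p) Y' =
    four_block_mat (X * X') (0\<^sub>m p m) (0\<^sub>m m p) (Y * Y' :: complex mat)"
proof -
  have "X * X' + 0\<^sub>m p m * 0\<^sub>m m p = X * X'" "X * 0\<^sub>m p m + 0\<^sub>m p m * Y' = 0\<^sub>m p m"
    "0\<^sub>m m p * X' + Y * 0\<^sub>m m p = 0\<^sub>m m p" "0\<^sub>m m p * 0\<^sub>m p m + Y * Y' = Y * Y'"
    using assms mult_carrier_mat[OF assms(1,2)] mult_carrier_mat[OF assms(3,4)] by auto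
  then show ?thesis
    by (subst mult_four_block_mat[OF assms(1) zero_carrier_mat zero_carrier_mat assms(3)
          assms(2) zero_carrier_mat zero_carrier_mat assms(4)]) simp
qed

text \<open>Induction on the size. A unitary \<open>W\<close> whose first column is a multiple of an eigenvector turns \<open>A\<close>
into \<open>W\<^sup>* A W\<close>, whose first column is supported on the diagonal. As this matrix is still Hermitian,
so is its first row: the matrix is block diagonal, and the induction hypothesis diagonalizes the
remaining block.\<close>

lemma spectral_theorem:
  assumes "hermitian A" "A \<in> carrier_mat n n"
  shows "\<exists>U d. U \<in> carrier_mat n n \<and> unitary U \<and> A = unitary_conj_diag U d"
  using assms
proof (induction n arbitrary: A)
  case 0
  have "unitary (1\<^sub>m 0)" by (rule unitaryI[of _ 0]) (auto intro!: eq_matI)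
  moreover have "A = unitary_conj_diag (1\<^sub>m 0) (\<lambda>_. 0)"
    by (rule eq_matI) (use 0 in \<open>auto simp: unitary_conj_diag_def\<close>)
  ultimately show ?case by (intro exI[of _ "1\<^sub>m 0"]) auto
next
  case (Suc m)
  let ?n = "Suc m"
  note A = Suc.prems(2)
  obtain v e where v: "v \<in> carrier_vec ?n" "v \<noteq> 0\<^sub>v ?n" "A *\<^sub>v v = e \<cdot>\<^sub>v v"
    using exists_eigenvector[OF A] by auto
  obtain W c where W: "W \<in> carrier_mat ?n ?n" "unitary W" "col W 0 = c \<cdot>\<^sub>v v"
    using exists_unitary_first_column[OF v(1,2)] by blast
  define W' where "W' = mat_adjoint W"
  have W': "W' \<in> carrier_mat ?n ?n" using W by (simp add: W'_def)
  have inv: "W' * W = 1\<^sub>m ?n" "W * W' = 1\<^sub>m ?n" using W by (auto simp: unitary_def W'_def)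
  define A' where "A' = W' * A * W"
  have colW: "col W 0 \<in> carrier_vec ?n" using W(1) by (metis carrier_matD(1) col_dim)
  have A': "A' \<in> carrier_mat ?n ?n" using A W W' by (simp add: A'_def)
  have adjA: "mat_adjoint A = A" using Suc.prems by (simp add: hermitian_def)
  have adjW': "mat_adjoint W' = W" using W unfolding W'_def by (intro mat_adjoint_adjoint)
  have adjA': "mat_adjoint A' = A'"
    using A W W' by (simp add: A'_def mat_adjoint_mult adjA adjW' W'_def[symmetric]
       assoc_mult_mat[of _ ?n ?n _ ?n _ ?n])
  have AA': "A = W * A' * W'"
  proof -
    have "W * A' * W' = (W * W') * A * (W * W')"
      using A W W' by (simp add: A'_def assoc_mult_mat[of _ ?n ?n _ ?n _ ?n])
    then show ?thesis using A by (simp add: inv)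
  qed
  have sym: "A' $$ (i, j) = cnj (A' $$ (j, i))" if "i < ?n" "j < ?n" for i j
    using mat_adjoint_index[of i A' j] that A' by (simp add: adjA')
  have col0: "A' $$ (i, 0) = (if i = 0 then e else 0)" if "i < ?n" for i
  proof -
    have "col A' 0 = (W' * A) *\<^sub>v col W 0"
      unfolding A'_def using A W W' by (intro col_mult2[of _ ?n ?n _ ?n]) auto
    also have "\<dots> = W' *\<^sub>v (A *\<^sub>v col W 0)"
      using A W' colW by (intro assoc_mult_mat_vec[of _ ?n ?n _ ?n]) auto
    also have "A *\<^sub>v col W 0 = e \<cdot>\<^sub>v col W 0"
      unfolding W(3) mult_mat_vec[OF A v(1)] v(3) by (simp add: smult_smult_assoc mult.commute)
    also have "W' *\<^sub>v (e \<cdot>\<^sub>v col W 0) = e \<cdot>\<^sub>v col (W' * W) 0"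
      using mult_mat_vec[OF W' colW, of e] col_mult2[OF W' W(1), of 0] by simp
    finally have "col A' 0 = e \<cdot>\<^sub>v col (1\<^sub>m ?n) 0" by (simp add: inv)
    from arg_cong[OF this, of "\<lambda>w. w $ i"] show ?thesis using that A' by auto
  qed
  have row0: "A' $$ (0, i) = (if i = 0 then e else 0)" if "i < ?n" for i
    using sym[of 0 i] col0[OF that] sym[of 0 0] col0[of 0] that by auto
  have "cnj e = e" using sym[of 0 0] col0[of 0] by auto
  then have e_real: "complex_of_real (Re e) = e" by (auto simp: complex_eq_iff)
  define A3 where "A3 = mat m m (\<lambda>(i, j). A' $$ (Suc i, Suc j))"
  have A3: "A3 \<in> carrier_mat m m" by (simp add: A3_def)
  have "mat_adjoint A3 = A3"
    by (rule eq_matI) (auto simp: A3_def sym[symmetric])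
  then have "hermitian A3" using A3 by (auto simp: hermitian_def)
  from Suc.IH[OF this A3] obtain U3 d3 where U3: "U3 \<in> carrier_mat m m" "unitary U3"
    and A3U: "A3 = unitary_conj_diag U3 d3" by blast
  define d where "d i = (case i of 0 \<Rightarrow> Re e | Suc j \<Rightarrow> d3 j)" for i
  define V where "V = four_block_mat (1\<^sub>m 1) (0\<^sub>m 1 m) (0\<^sub>m m 1) U3"
  define V' where "V' = four_block_mat (1\<^sub>m 1) (0\<^sub>m 1 m) (0\<^sub>m m 1) (mat_adjoint U3)"
  note U3' = mat_adjoint_carrier[OF U3(1)]
  have V: "V \<in> carrier_mat ?n ?n" and V': "V' \<in> carrier_mat ?n ?n"
    using four_block_carrier_mat[of "1\<^sub>m 1" 1 1 U3 m m] four_block_carrier_mat[of "1\<^sub>m 1" 1 1 "mat_adjoint U3" m m]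
      U3 U3' by (auto simp: V_def V'_def)
  have V'V: "V' = mat_adjoint V"
    by (rule eq_matI) (use U3 in \<open>auto simp: V_def V'_def\<close>)
  have "V' * V = four_block_mat (1\<^sub>m 1) (0\<^sub>m 1 m) (0\<^sub>m m 1) (mat_adjoint U3 * U3)"
    unfolding V_def V'_def using U3 U3' by (simp add: block_diag_mult)
  also have "\<dots> = 1\<^sub>m ?n" using U3 by (auto simp: unitary_def)
  finally have uV: "unitary V" using V by (intro unitaryI[OF V]) (simp add: V'V)
  have D: "mat_diag ?n (\<lambda>i. complex_of_real (d i)) =
      four_block_mat (mat 1 1 (\<lambda>_. e)) (0\<^sub>m 1 m) (0\<^sub>m m 1) (mat_diag m (\<lambda>i. complex_of_real (d3 i)))"
    by (rule eq_matI) (use e_real in \<open>auto simp: mat_diag_def d_def split: nat.splits\<close>)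
  have "A' = four_block_mat (mat 1 1 (\<lambda>_. e)) (0\<^sub>m 1 m) (0\<^sub>m m 1) A3"
    by (rule eq_matI) (use A' A3 col0 row0 in \<open>auto simp: A3_def\<close>)
  also have "\<dots> = V * mat_diag ?n (\<lambda>i. complex_of_real (d i)) * V'"
    unfolding V_def V'_def D A3U unitary_conj_diag_def using U3 U3'
    by (simp add: block_diag_mult)
  finally have A'V: "A' = V * mat_diag ?n (\<lambda>i. complex_of_real (d i)) * V'" .
  define Dm where "Dm = mat_diag ?n (\<lambda>i. complex_of_real (d i))"
  have Dm: "Dm \<in> carrier_mat ?n ?n" by (simp add: Dm_def)
  have "A = W * V * Dm * (V' * W')"
    unfolding AA' A'V Dm_def[symmetric]
    using W(1) W' V V' Dm by (simp add: assoc_mult_mat[of _ ?n ?n _ ?n _ ?n])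
  also have "V' * W' = mat_adjoint (W * V)"
    using W V by (simp add: mat_adjoint_mult V'V W'_def)
  finally have "A = unitary_conj_diag (W * V) d" using W V by (simp add: unitary_conj_diag_def Dm_def)
  then show ?case using unitary_mult[OF W(2) uV W(1) V] W V by (intro exI[of _ "W * V"] exI[of _ d]) auto
qed

section \<open>The trace pairing and the functional calculus\<close>

lemma trace_mult:
  assumes "A \<in> carrier_mat n m" "B \<in> carrier_mat m n"
  shows "trace (A * B) = (\<Sum>i<n. \<Sum>j<m. A $$ (i, j) * B $$ (j, i))"
  using assms by (auto simp: trace_def scalar_prod_def atLeast0LessThan)

lemma trace_mult_comm:
  assumes "A \<in> carrier_mat n m" "B \<in> carrier_mat m n"
  shows "trace (A * B) = trace (B * A)"
  unfolding trace_mult[OF assms] trace_mult[OF assms(2,1)]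
  by (subst sum.swap) (simp add: mult.commute)

text \<open>The argument needs matrix inequalities only after pairing them with a positive semidefinite matrix.
For Hermitian arguments the trace is real, so taking the real part loses nothing (\<open>trace_hermitian_mult_real\<close>).\<close>

definition trace_prod :: "complex mat \<Rightarrow> complex mat \<Rightarrow> real" where
  "trace_prod X Y = Re (trace (X * Y))"

lemma trace_prod_sum:
  assumes "X \<in> carrier_mat n n" "Y \<in> carrier_mat n n"
  shows "trace_prod X Y = (\<Sum>i<n. \<Sum>j<n. Re (X $$ (i, j) * Y $$ (j, i)))"
  using assms by (simp add: trace_prod_def trace_mult)

lemma trace_prod_linear:
  assumes "X \<in> carrier_mat n n" "Y \<in> carrier_mat n n" "Z \<in> carrier_mat n n"
  shows "trace_prod X (Y + Z) = trace_prod X Y + trace_prod X Z"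
    and "trace_prod X (Y - Z) = trace_prod X Y - trace_prod X Z"
    and "trace_prod (X - Y) Z = trace_prod X Z - trace_prod Y Z"
  using assms
  by (simp_all add: trace_prod_sum[of _ n] minus_carrier_mat ring_distribs sum.distrib sum_subtractf
      del: times_complex.sel)

lemma trace_prod_smult:
  assumes "X \<in> carrier_mat n n" "Y \<in> carrier_mat n n"
  shows "trace_prod X (complex_of_real t \<cdot>\<^sub>m Y) = t * trace_prod X Y"
    and "trace_prod (complex_of_real t \<cdot>\<^sub>m X) Y = t * trace_prod X Y"
  using assms
  by (simp_all add: trace_prod_sum[of _ n] sum_distrib_left algebra_simps)

lemma dim_unitary_conj_diag [simp]:
  "dim_row (unitary_conj_diag U d) = dim_row U" "dim_col (unitary_conj_diag U d) = dim_row U"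
  by (simp_all add: unitary_conj_diag_def)

lemma unitary_conj_diag_linear:
  assumes "U \<in> carrier_mat n n"
  shows "unitary_conj_diag U a + unitary_conj_diag U b = unitary_conj_diag U (\<lambda>i. a i + b i)"
    and "unitary_conj_diag U a - unitary_conj_diag U b = unitary_conj_diag U (\<lambda>i. a i - b i)"
    and "complex_of_real t \<cdot>\<^sub>m unitary_conj_diag U a = unitary_conj_diag U (\<lambda>i. t * a i)"
  unfolding unitary_conj_diag_def using assms
  by (intro eq_matI;
      auto simp: mat_diag_mult_right[of _ n n] scalar_prod_def algebra_simps sum.distrib
        sum_subtractf sum_distrib_left)+

lemma unitary_conj_diag_cong:
  assumes "U \<in> carrier_mat n n" "\<And>i. i < n \<Longrightarrow> a i = b i"
  shows "unitary_conj_diag U a = unitary_conj_diag U b"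
proof -
  have "mat_diag n (\<lambda>i. complex_of_real (a i)) = mat_diag n (\<lambda>i. complex_of_real (b i))"
    by (rule eq_matI) (use assms in \<open>auto simp: mat_diag_def\<close>)
  then show ?thesis using assms by (simp add: unitary_conj_diag_def)
qed

lemma unitary_conj_diag_mult:
  assumes "U \<in> carrier_mat n n" "unitary U"
  shows "unitary_conj_diag U a * unitary_conj_diag U b = unitary_conj_diag U (\<lambda>i. a i * b i)"
proof -
  define U' where "U' = mat_adjoint U"
  have C: "U \<in> carrier_mat n n" "U' \<in> carrier_mat n n" using assms by (auto simp: U'_def)
  have inv: "U' * U = 1\<^sub>m n" using assms by (auto simp: U'_def unitary_def)
  define Da Db where "Da = mat_diag n (\<lambda>i. complex_of_real (a i))"
    and "Db = mat_diag n (\<lambda>i. complex_of_real (b i))"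
  have D: "Da \<in> carrier_mat n n" "Db \<in> carrier_mat n n" by (auto simp: Da_def Db_def)
  have "U * Da * U' * (U * Db * U') = U * Da * (U' * U) * Db * U'"
    using C D by (simp add: assoc_mult_mat[of _ n n _ n _ n])
  also have "\<dots> = U * (Da * Db) * U'"
    using C D by (simp add: inv assoc_mult_mat[of _ n n _ n _ n])
  also have "Da * Db = mat_diag n (\<lambda>i. complex_of_real (a i * b i))"
    by (simp add: Da_def Db_def)
  finally show ?thesis using C by (simp add: unitary_conj_diag_def U'_def Da_def Db_def)
qed

lemma hermitian_unitary_conj_diag:
  assumes "U \<in> carrier_mat n n"
  shows "hermitian (unitary_conj_diag U d)"
proof -
  define U' where "U' = mat_adjoint U"
  have C: "U' \<in> carrier_mat n n" "mat_adjoint U' = U" using assms by (auto simp: U'_def)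
  define D where "D = mat_diag n (\<lambda>i. complex_of_real (d i))"
  have D: "D \<in> carrier_mat n n" "mat_adjoint D = D" by (simp_all add: D_def)
  have "mat_adjoint (U * D * U') = U * D * U'"
    using D assms C by (simp add: mat_adjoint_mult U'_def[symmetric] assoc_mult_mat[of _ n n _ n _ n])
  then show ?thesis using assms C by (simp add: hermitian_def unitary_conj_diag_def D_def flip: U'_def)
qed

lemma hermitian_minus:
  assumes "X \<in> carrier_mat n n" "Y \<in> carrier_mat n n" "hermitian X" "hermitian Y"
  shows "hermitian (X - Y)"
proof -
  have "mat_adjoint (X - Y) = mat_adjoint X - mat_adjoint Y"
    using assms by (intro eq_matI) auto
  then show ?thesis using assms by (auto simp: hermitian_def)
qed

lemma quadratic_form_unitary_conj_diag:
  assumes U: "U \<in> carrier_mat n n" and v: "v \<in> carrier_vec n"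
  shows "(unitary_conj_diag U d *\<^sub>v v) \<bullet>c v =
    complex_of_real (\<Sum>i<n. d i * (cmod ((mat_adjoint U *\<^sub>v v) $ i))\<^sup>2)"
proof -
  define D where "D = mat_diag n (\<lambda>i. complex_of_real (d i))"
  define w where "w = mat_adjoint U *\<^sub>v v"
  have D: "D \<in> carrier_mat n n" by (simp add: D_def)
  have U': "mat_adjoint U \<in> carrier_mat n n" using U by simp
  have w: "w \<in> carrier_vec n" using U' v unfolding w_def by (rule mult_mat_vec_carrier)
  have "unitary_conj_diag U d *\<^sub>v v = (U * D * mat_adjoint U) *\<^sub>v v"
    using U by (simp add: unitary_conj_diag_def D_def)
  also have "\<dots> = U *\<^sub>v (D *\<^sub>v w)"
    using U U' v D w assoc_mult_mat_vec[of "U * D" n n "mat_adjoint U" n v] assoc_mult_mat_vec[of U n n D n w]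
    by (simp add: w_def)
  finally have "(unitary_conj_diag U d *\<^sub>v v) \<bullet>c v = (D *\<^sub>v w) \<bullet>c w"
    using cscalar_prod_adjoint[OF U _ v, of "D *\<^sub>v w"] D w by (simp add: w_def)
  also have "\<dots> = (\<Sum>i<n. (\<Sum>j<n. D $$ (i, j) * w $ j) * cnj (w $ i))"
    using D w by (auto simp: scalar_prod_def atLeast0LessThan)
  also have "\<dots> = (\<Sum>i<n. complex_of_real (d i) * w $ i * cnj (w $ i))"
    by (intro sum.cong refl) (auto simp: D_def mat_diag_def if_distrib[of "\<lambda>x. x * _"] cong: if_cong)
  also have "\<dots> = complex_of_real (\<Sum>i<n. d i * (cmod (w $ i))\<^sup>2)"
    by (simp add: complex_norm_square mult.assoc del: of_real_power)
  finally show ?thesis by (simp add: w_def)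
qed

lemma trace_unitary_conj_diag_mult:
  assumes V: "V \<in> carrier_mat n n" and Z: "Z \<in> carrier_mat n n"
  shows "trace (unitary_conj_diag V c * Z) =
    (\<Sum>i<n. complex_of_real (c i) * ((Z *\<^sub>v col V i) \<bullet>c col V i))"
proof -
  define D where "D = mat_diag n (\<lambda>i. complex_of_real (c i))"
  define V' where "V' = mat_adjoint V"
  have C: "V' \<in> carrier_mat n n" "D \<in> carrier_mat n n" using V by (auto simp: V'_def D_def)
  have "trace (V * D * V' * Z) = trace (V * (D * V' * Z))"
    using V Z C by (simp add: assoc_mult_mat[of _ n n _ n _ n])
  also have "\<dots> = trace (D * V' * Z * V)"
    using V Z C by (intro trace_mult_comm[of _ n n]) auto
  also have "\<dots> = trace (D * (V' * (Z * V)))"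
    using V Z C by (simp add: assoc_mult_mat[of _ n n _ n _ n])
  also have "\<dots> = (\<Sum>i<n. complex_of_real (c i) * (V' * (Z * V)) $$ (i, i))"
    using V Z C by (auto simp: trace_def D_def mat_diag_mult_left[of _ n n])
  also have "\<dots> = (\<Sum>i<n. complex_of_real (c i) * ((Z *\<^sub>v col V i) \<bullet>c col V i))"
  proof (intro sum.cong refl)
    fix i assume "i \<in> {..<n}"
    then have i: "i < n" by simp
    have ZV: "col (Z * V) i = Z *\<^sub>v col V i" using col_mult2[OF Z V i] .
    have "row V' i = conjugate (col V i)"
      by (rule eq_vecI) (use i V in \<open>auto simp: V'_def\<close>)
    then have "(V' * (Z * V)) $$ (i, i) = conjugate (col V i) \<bullet> (Z *\<^sub>v col V i)"
      using i V Z C ZV by simp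
    also have "\<dots> = (Z *\<^sub>v col V i) \<bullet>c col V i"
      by (rule comm_scalar_prod[of _ n]) (use i V Z in auto)
    finally show "complex_of_real (c i) * (V' * (Z * V)) $$ (i, i) =
      complex_of_real (c i) * ((Z *\<^sub>v col V i) \<bullet>c col V i)" by simp
  qed
  finally show ?thesis using V by (simp add: unitary_conj_diag_def D_def V'_def)
qed

text \<open>The transition probabilities \<open>\<bar>\<langle>v\<^sub>i, u\<^sub>j\<rangle>\<bar>\<^sup>2\<close> between two orthonormal bases, given by the columns of
\<open>V\<close> and \<open>U\<close>. They form a doubly stochastic matrix, which reduces trace inequalities for
non-commuting matrices to scalar inequalities between eigenvalues.\<close>

definition overlap :: "complex mat \<Rightarrow> complex mat \<Rightarrow> nat \<Rightarrow> nat \<Rightarrow> real" where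
  "overlap V U i j = (cmod ((mat_adjoint V * U) $$ (i, j)))\<^sup>2"

lemma overlap_nonneg [simp]: "0 \<le> overlap V U i j"
  by (simp add: overlap_def)

lemma overlap_commute:
  assumes "U \<in> carrier_mat n n" "V \<in> carrier_mat n n" "i < n" "j < n"
  shows "overlap V U i j = overlap U V j i"
proof -
  have "mat_adjoint V * U = mat_adjoint (mat_adjoint U * V)"
    using assms by (simp add: mat_adjoint_mult)
  then have "(mat_adjoint V * U) $$ (i, j) = cnj ((mat_adjoint U * V) $$ (j, i))"
    using assms by simp
  then show ?thesis by (simp add: overlap_def)
qed

lemma trace_two_unitary_conj_diag:
  assumes V: "V \<in> carrier_mat n n" and U: "U \<in> carrier_mat n n"
  shows "trace (unitary_conj_diag V c * unitary_conj_diag U d) =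
    complex_of_real (\<Sum>i<n. \<Sum>j<n. c i * d j * overlap V U i j)"
proof -
  have "(unitary_conj_diag U d *\<^sub>v col V i) \<bullet>c col V i =
      complex_of_real (\<Sum>j<n. d j * overlap V U i j)" if i: "i < n" for i
  proof -
    have "(mat_adjoint U *\<^sub>v col V i) = col (mat_adjoint U * V) i"
      using col_mult2[of "mat_adjoint U" n n V n i] U V i by simp
    then have "(cmod ((mat_adjoint U *\<^sub>v col V i) $ j))\<^sup>2 = overlap V U i j" if "j < n" for j
      using U V i that by (simp add: overlap_commute[OF U V i that]) (simp add: overlap_def)
    then show ?thesis using V i by (simp add: quadratic_form_unitary_conj_diag[OF U])
  qed
  then show ?thesis
    using U V by (simp add: trace_unitary_conj_diag_mult sum_distrib_left mult.assoc)
qed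

lemma overlap_sum_right:
  assumes V: "V \<in> carrier_mat n n" "unitary V" and U: "U \<in> carrier_mat n n" "unitary U" and i: "i < n"
  shows "(\<Sum>j<n. overlap V U i j) = 1"
proof -
  define U' V' where "U' = mat_adjoint U" and "V' = mat_adjoint V"
  have C: "U' \<in> carrier_mat n n" "V' \<in> carrier_mat n n" using U V by (auto simp: U'_def V'_def)
  have inv: "U * U' = 1\<^sub>m n" "V' * V = 1\<^sub>m n" using U V by (auto simp: U'_def V'_def unitary_def)
  have adj: "mat_adjoint U = U'" "mat_adjoint V' = V" by (simp_all add: U'_def V'_def)
  have VU: "V' * U \<in> carrier_mat n n" using C U by auto
  have "V' * U * mat_adjoint (V' * U) = V' * (U * U') * V"
    using U(1) V(1) C adj by (simp add: mat_adjoint_mult assoc_mult_mat[of _ n n _ n _ n])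
  also have "\<dots> = 1\<^sub>m n" using C V inv by simp
  finally have "(V' * U * mat_adjoint (V' * U)) $$ (i, i) = 1" using i by simp
  moreover have "(M * mat_adjoint M) $$ (i, i) = (\<Sum>j<n. M $$ (i, j) * cnj (M $$ (i, j)))"
    if "M \<in> carrier_mat n n" for M using that i by (simp add: scalar_prod_def atLeast0LessThan)
  ultimately have "(\<Sum>j<n. (V' * U) $$ (i, j) * cnj ((V' * U) $$ (i, j))) = 1"
    using VU by simp
  then have "complex_of_real (\<Sum>j<n. overlap V U i j) = complex_of_real 1"
    by (simp add: overlap_def V'_def complex_norm_square del: of_real_power)
  then show ?thesis using of_real_eq_iff by blast
qed

lemma overlap_sum_left:
  assumes "V \<in> carrier_mat n n" "unitary V" "U \<in> carrier_mat n n" "unitary U" "j < n"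
  shows "(\<Sum>i<n. overlap V U i j) = 1"
  using overlap_sum_right[OF assms(3,4,1,2,5)] overlap_commute[OF assms(3,1) _ assms(5)] by simp

lemma trace_unitary_conj_diag:
  assumes U: "U \<in> carrier_mat n n" "unitary U"
  shows "trace (unitary_conj_diag U d) = complex_of_real (\<Sum>i<n. d i)"
proof -
  define D where "D = mat_diag n (\<lambda>i. complex_of_real (d i))"
  define U' where "U' = mat_adjoint U"
  have C: "U' \<in> carrier_mat n n" "D \<in> carrier_mat n n" using U by (auto simp: U'_def D_def)
  have inv: "U' * U = 1\<^sub>m n" using U by (auto simp: U'_def unitary_def)
  have "trace (U * D * U') = trace (U' * (U * D))"
    using U C by (intro trace_mult_comm[of _ n n]) auto
  also have "U' * (U * D) = (U' * U) * D" using U C by (intro assoc_mult_mat[symmetric, of _ n n _ n _ n])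
  also have "\<dots> = D" using C inv by simp
  finally show ?thesis using U by (simp add: unitary_conj_diag_def U'_def D_def) (simp add: trace_def mat_diag_def)
qed

definition psd_mats :: "nat \<Rightarrow> complex mat set" where
  "psd_mats n = {X \<in> carrier_mat n n. psd X}"

lemma psd_matsD: "X \<in> psd_mats n \<Longrightarrow> X \<in> carrier_mat n n"
  by (simp add: psd_mats_def)

lemma unitary_conj_diag_psd:
  assumes "U \<in> carrier_mat n n" "\<And>i. i < n \<Longrightarrow> 0 \<le> d i"
  shows "unitary_conj_diag U d \<in> psd_mats n"
  using assms unitary_conj_diag_carrier[OF assms(1), of d]
  by (auto simp: psd_mats_def psd_def hermitian_unitary_conj_diag quadratic_form_unitary_conj_diag[OF assms(1)]
      less_eq_complex_def simp del: of_real_sum of_real_mult index_mult_mat_vec intro!: sum_nonneg)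

lemma psd_spectral:
  assumes "X \<in> psd_mats n"
  obtains U d where "U \<in> carrier_mat n n" "unitary U" "X = unitary_conj_diag U d"
    "\<And>i. i < n \<Longrightarrow> 0 \<le> d i"
proof -
  have X: "X \<in> carrier_mat n n" "hermitian X" "psd X" using assms by (auto simp: psd_mats_def psd_def)
  obtain U d where U: "U \<in> carrier_mat n n" "unitary U" "X = unitary_conj_diag U d"
    using spectral_theorem[OF X(2,1)] by blast
  \<comment> \<open>The \<open>i\<close>-th eigenvalue is the value of the quadratic form at the \<open>i\<close>-th column of \<open>U\<close>.\<close>
  have "0 \<le> d i" if i: "i < n" for i
  proof -
    have *: "mat_adjoint U *\<^sub>v col U i = unit_vec n i"
      using col_mult2[of "mat_adjoint U" n n U n i] U i by (simp add: unitary_def)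
    have "0 \<le> (X *\<^sub>v col U i) \<bullet>c col U i" using X U i by (simp add: psd_def)
    also have "\<dots> = complex_of_real (\<Sum>j<n. d j * (cmod (unit_vec n i $ j))\<^sup>2)"
      using U i by (simp add: quadratic_form_unitary_conj_diag *)
    also have "(\<Sum>j<n. d j * (cmod (unit_vec n i $ j))\<^sup>2) = (\<Sum>j<n. if j = i then d j else 0)"
      using i by (intro sum.cong) (auto simp: unit_vec_def)
    also have "\<dots> = d i" using i by simp
    finally show ?thesis by (simp add: less_eq_complex_def)
  qed
  with U that show thesis by blast
qed

lemma psd_add:
  assumes "X \<in> psd_mats n" "Y \<in> psd_mats n"
  shows "X + Y \<in> psd_mats n"
proof -
  have C: "X \<in> carrier_mat n n" "Y \<in> carrier_mat n n" using assms by (auto simp: psd_matsD)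
  have "((X + Y) *\<^sub>v v) \<bullet>c v = (X *\<^sub>v v) \<bullet>c v + (Y *\<^sub>v v) \<bullet>c v" if "v \<in> carrier_vec n" for v
    using that C by (simp add: add_mult_distrib_mat_vec[of _ n n] add_scalar_prod_distrib[of _ n])
  then show ?thesis using assms
    by (auto simp: psd_mats_def psd_def hermitian_def mat_adjoint_add intro: add_nonneg_nonneg)
qed

lemma psd_smult:
  assumes "X \<in> psd_mats n" "0 \<le> t"
  shows "complex_of_real t \<cdot>\<^sub>m X \<in> psd_mats n"
  using assms by (elim psd_spectral) (auto simp: unitary_conj_diag_linear intro!: unitary_conj_diag_psd)

lemma trace_prod_nonneg:
  assumes "X \<in> psd_mats n" "Y \<in> psd_mats n"
  shows "0 \<le> trace_prod X Y"
proof -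
  from assms obtain U d V e where *: "U \<in> carrier_mat n n" "X = unitary_conj_diag U d"
    "\<And>i. i < n \<Longrightarrow> 0 \<le> d i" "V \<in> carrier_mat n n" "Y = unitary_conj_diag V e" "\<And>i. i < n \<Longrightarrow> 0 \<le> e i"
    by (metis psd_spectral)
  then show ?thesis
    by (auto simp: trace_prod_def trace_two_unitary_conj_diag simp del: of_real_sum of_real_mult
        intro!: sum_nonneg mult_nonneg_nonneg)
qed

lemma trace_hermitian_mult_real:
  assumes "X \<in> carrier_mat n n" "Y \<in> carrier_mat n n" "hermitian X" "hermitian Y"
  shows "trace (X * Y) = complex_of_real (trace_prod X Y)"
proof -
  from assms obtain U d V e where *: "U \<in> carrier_mat n n" "X = unitary_conj_diag U d"
    "V \<in> carrier_mat n n" "Y = unitary_conj_diag V e"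
    by (metis spectral_theorem)
  then show ?thesis
    by (auto simp: trace_prod_def trace_two_unitary_conj_diag simp del: of_real_sum of_real_mult)
qed

lemma mat_fun_hermitian:
  assumes "X \<in> carrier_mat n n" "hermitian X"
  shows "mat_fun f X \<in> carrier_mat n n" "hermitian (mat_fun f X)"
proof -
  obtain U d where U: "U \<in> carrier_mat n n" "unitary U" "X = unitary_conj_diag U d"
    using spectral_theorem[OF assms(2,1)] by blast
  then show "mat_fun f X \<in> carrier_mat n n" "hermitian (mat_fun f X)"
    by (auto simp: mat_fun_unitary_conj_diag hermitian_unitary_conj_diag)
qed

lemma mat_fun_carrier [simp]: "X \<in> psd_mats n \<Longrightarrow> mat_fun f X \<in> carrier_mat n n"
  by (auto simp: psd_mats_def psd_def mat_fun_hermitian)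

lemma trace_prod_common_eigenbasis:
  assumes "U \<in> carrier_mat n n" "unitary U"
  shows "trace_prod (unitary_conj_diag U c) (unitary_conj_diag U d) = (\<Sum>i<n. c i * d i)"
  using assms by (simp add: trace_prod_def unitary_conj_diag_mult trace_unitary_conj_diag)

text \<open>The hypothesis says that \<open>f x\<close> is a subgradient of \<open>F\<close> at \<open>x\<close>. Both sides are weighted sums of the
two sides of this scalar inequality, taken at pairs of eigenvalues of \<open>X\<close> and \<open>Y\<close> with the overlaps of
the eigenbases as weights.\<close>

lemma Klein_inequality:
  assumes F: "\<And>x y. 0 \<le> x \<Longrightarrow> 0 \<le> y \<Longrightarrow> f x * (y - x) \<le> F y - F x"
    and X: "X \<in> psd_mats n" and Y: "Y \<in> psd_mats n"
  shows "trace_prod (Y - X) (mat_fun f X) \<le> Re (trace (mat_fun F Y)) - Re (trace (mat_fun F X))"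
proof -
  obtain U x where U: "U \<in> carrier_mat n n" "unitary U" "X = unitary_conj_diag U x"
    "\<And>i. i < n \<Longrightarrow> 0 \<le> x i" using psd_spectral[OF X] by metis
  obtain V y where V: "V \<in> carrier_mat n n" "unitary V" "Y = unitary_conj_diag V y"
    "\<And>i. i < n \<Longrightarrow> 0 \<le> y i" using psd_spectral[OF Y] by metis
  let ?w = "overlap V U"
  have col: "(\<Sum>i<n. \<Sum>j<n. g j * ?w i j) = (\<Sum>j<n. g j)" for g
    by (subst sum.swap) (use overlap_sum_left[OF V(1,2) U(1,2)] in \<open>simp flip: sum_distrib_left\<close>)
  have row: "(\<Sum>i<n. \<Sum>j<n. g i * ?w i j) = (\<Sum>i<n. g i)" for g
    using overlap_sum_right[OF V(1,2) U(1,2)] by (simp flip: sum_distrib_left)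
  have "trace_prod (Y - X) (mat_fun f X) = trace_prod Y (mat_fun f X) - trace_prod X (mat_fun f X)"
    using X Y by (intro trace_prod_linear(3)[of _ n]) (auto simp: psd_matsD)
  also have "trace_prod Y (mat_fun f X) = (\<Sum>i<n. \<Sum>j<n. y i * f (x j) * ?w i j)"
    using U V by (simp add: trace_prod_def mat_fun_unitary_conj_diag trace_two_unitary_conj_diag)
  also have "trace_prod X (mat_fun f X) = (\<Sum>i<n. \<Sum>j<n. x j * f (x j) * ?w i j)"
    using U by (simp add: mat_fun_unitary_conj_diag trace_prod_common_eigenbasis col)
  also have "(\<Sum>i<n. \<Sum>j<n. y i * f (x j) * ?w i j) - (\<Sum>i<n. \<Sum>j<n. x j * f (x j) * ?w i j)
      = (\<Sum>i<n. \<Sum>j<n. f (x j) * (y i - x j) * ?w i j)"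
    by (simp add: algebra_simps flip: sum_subtractf)
  also have "\<dots> \<le> (\<Sum>i<n. \<Sum>j<n. (F (y i) - F (x j)) * ?w i j)"
    using U V by (intro sum_mono mult_right_mono F) auto
  also have "\<dots> = (\<Sum>i<n. \<Sum>j<n. F (y i) * ?w i j) - (\<Sum>i<n. \<Sum>j<n. F (x j) * ?w i j)"
    by (simp add: algebra_simps flip: sum_subtractf)
  also have "\<dots> = Re (trace (mat_fun F Y)) - Re (trace (mat_fun F X))"
    using U V by (simp add: mat_fun_unitary_conj_diag trace_unitary_conj_diag row[of "\<lambda>i. F (y i)"] col[of "\<lambda>i. F (x i)"])
  finally show ?thesis .
qed

text \<open>In this form, with \<open>t\<close> of either sign, the inequality is a substitute for the formula
\<open>d/dt Tr F(X + t C) = Tr (C f(X + t C))\<close>.\<close>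

lemma Klein_inequality_along_line:
  assumes "\<And>x y. 0 \<le> x \<Longrightarrow> 0 \<le> y \<Longrightarrow> f x * (y - x) \<le> F y - F x"
    and "X \<in> psd_mats n" "Y \<in> psd_mats n" "C \<in> carrier_mat n n"
    and "Y - X = complex_of_real t \<cdot>\<^sub>m C"
  shows "t * trace_prod C (mat_fun f X) \<le> Re (trace (mat_fun F Y)) - Re (trace (mat_fun F X))"
  using Klein_inequality[where f = f and F = F, OF assms(1-3)] assms(2,4)
  by (simp add: assms(5) trace_prod_smult[of _ n])

section \<open>Convex functions on a half-line\<close>

text \<open>An antiderivative of a nondecreasing function is convex, with the function as a subgradient.\<close>

lemma mono_subgradient_exists:
  fixes f :: "real \<Rightarrow> real"
  assumes mono: "mono_on {0..} f"
  shows "\<exists>F. \<forall>x \<ge> 0. \<forall>y \<ge> 0. f x * (y - x) \<le> F y - F x"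
proof (intro exI allI impI)
  define F where "F x = integral {0..x} f" for x
  have int: "f integrable_on {a..b}" if "0 \<le> a" for a b
    by (rule integrable_on_mono_on) (use that in \<open>auto intro: mono_on_subset[OF mono]\<close>)
  have diff: "F b - F a = integral {a..b} f" if "0 \<le> a" "a \<le> b" for a b
    using Henstock_Kurzweil_Integration.integral_combine[OF that int] by (simp add: F_def)
  fix x y :: real assume xy: "0 \<le> x" "0 \<le> y"
  show "f x * (y - x) \<le> F y - F x"
  proof (cases "x \<le> y")
    case True
    have "integral {x..y} (\<lambda>_. f x) \<le> integral {x..y} f"
      using xy by (intro integral_le int) (auto intro: mono_onD[OF mono])
    then show ?thesis using diff[OF xy(1) True] True by (simp add: mult.commute)
  next
    case False
    have "integral {y..x} f \<le> integral {y..x} (\<lambda>_. f x)"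
      using xy by (intro integral_le int) (auto intro: mono_onD[OF mono])
    then show ?thesis using diff[OF xy(2), of x] False by (simp add: algebra_simps)
  qed
qed

lemma convex_nonneg_imp_mono:
  fixes f :: "real \<Rightarrow> real"
  assumes "convex_on {0..} f" "\<And>x. 0 \<le> x \<Longrightarrow> 0 \<le> f x" "f 0 = 0"
  shows "mono_on {0..} f"
proof (rule mono_onI)
  fix x y :: real assume xy: "x \<in> {0..}" "y \<in> {0..}" "x \<le> y"
  show "f x \<le> f y"
  proof (cases "y = 0")
    case False
    then have y: "0 < y" using xy by simp
    have "f ((1 - x / y) * 0 + (x / y) * y) \<le> (1 - x / y) * f 0 + (x / y) * f y"
      using convex_onD[OF assms(1), of "x / y" 0 y] xy y by simp
    also have "\<dots> \<le> f y"
      using xy y assms(2)[of y] mult_right_mono[of "x / y" 1 "f y"] by (simp add: assms(3))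
    finally show ?thesis using y by simp
  qed (use xy in simp)
qed

lemma convex_scale_le:
  fixes f :: "real \<Rightarrow> real"
  assumes "convex_on {0..} f" "f 0 = 0" "0 \<le> t" "t \<le> 1" "0 \<le> x"
  shows "f (t * x) \<le> t * f x"
  using convex_onD[OF assms(1), of t 0 x] assms by simp

text \<open>A convex function on a half-line that increases somewhere grows at least linearly from there on.\<close>

lemma convex_on_bounded_imp_le:
  fixes \<phi> :: "real \<Rightarrow> real"
  assumes conv: "convex_on {0..} \<phi>" and bound: "\<And>t. 0 \<le> t \<Longrightarrow> \<phi> t \<le> K"
  shows "\<phi> 1 \<le> \<phi> 0"
proof (rule ccontr)
  assume "\<not> \<phi> 1 \<le> \<phi> 0"
  then have pos: "0 < \<phi> 1 - \<phi> 0" by simp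
  \<comment> \<open>At this \<open>t\<close> the line through the values at \<open>0\<close> and \<open>1\<close> is above the bound \<open>K\<close>.\<close>
  define t where "t = 1 + (K - \<phi> 0 + 1) / (\<phi> 1 - \<phi> 0)"
  have K: "0 \<le> K - \<phi> 0" using bound[of 0] by simp
  then have t: "1 \<le> t" using pos by (simp add: t_def)
  have "\<phi> 1 \<le> (1 - 1 / t) * \<phi> 0 + (1 / t) * \<phi> t"
    using convex_onD[OF conv, of "1 / t" 0 t] t by simp
  then have "t * \<phi> 1 \<le> t * ((1 - 1 / t) * \<phi> 0 + (1 / t) * \<phi> t)"
    using t by (intro mult_left_mono) auto
  also have "\<dots> = (t - 1) * \<phi> 0 + \<phi> t" using t by (simp add: field_simps)
  finally have "t * (\<phi> 1 - \<phi> 0) \<le> K - \<phi> 0" using bound[of t] t by (simp add: algebra_simps)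
  moreover have "t * (\<phi> 1 - \<phi> 0) = (\<phi> 1 - \<phi> 0) + (K - \<phi> 0 + 1)"
    using pos by (simp add: t_def field_simps)
  ultimately show False using pos by simp
qed

text \<open>The points \<open>1\<close> and \<open>h\<close> lie between \<open>0\<close> and \<open>1 + h\<close> and have the same sum.\<close>

lemma convex_on_swap_le:
  fixes \<phi> :: "real \<Rightarrow> real"
  assumes conv: "convex_on {0..} \<phi>" and h: "0 < h"
  shows "\<phi> 1 + \<phi> h \<le> \<phi> (1 + h) + \<phi> 0"
proof -
  have "\<phi> 1 \<le> (1 - 1 / (1 + h)) * \<phi> 0 + (1 / (1 + h)) * \<phi> (1 + h)"
    using convex_onD[OF conv, of "1 / (1 + h)" 0 "1 + h"] h by simp
  moreover have "\<phi> h \<le> (1 - h / (1 + h)) * \<phi> 0 + (h / (1 + h)) * \<phi> (1 + h)"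
    using convex_onD[OF conv, of "h / (1 + h)" 0 "1 + h"] h by simp
  ultimately have "\<phi> 1 + \<phi> h \<le> (2 - (1 / (1 + h) + h / (1 + h))) * \<phi> 0 + (1 / (1 + h) + h / (1 + h)) * \<phi> (1 + h)"
    by (simp add: algebra_simps)
  moreover have "1 / (1 + h) + h / (1 + h) = 1" using h by (simp flip: add_divide_distrib)
  ultimately show ?thesis by simp
qed

text \<open>For smooth \<open>H\<close> the first hypothesis says that \<open>E = \<partial>H/\<partial>u\<close> and that \<open>H\<close> is convex in \<open>u\<close>, and the conclusion
is \<open>\<integral>\<^sub>0\<^sup>1 (E u (1 + h) - E u 1 - E u h + E u 0) du \<ge> 0\<close>, where the integrand is nonnegative by convexity in
the second argument. In general \<open>E u\<close> is only a subgradient of \<open>H\<close>, so the integral is compared with Riemann sums of step \<open>1/N\<close>: the first hypothesis bounds the error of each step by \<open>1/N\<close>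
times an increment of \<open>R\<close>, and the increments telescope.\<close>

lemma mixed_difference_le:
  fixes H E :: "real \<Rightarrow> real \<Rightarrow> real"
  assumes Hu: "\<And>u u' s. 0 \<le> u \<Longrightarrow> 0 \<le> u' \<Longrightarrow> 0 \<le> s \<Longrightarrow> (u' - u) * E u s \<le> H u' s - H u s"
    and conv: "\<And>u. 0 \<le> u \<Longrightarrow> convex_on {0..} (E u)"
    and h: "0 < h"
  shows "H 0 (1 + h) - H 0 1 - H 0 h + H 0 0 \<le> H 1 (1 + h) - H 1 1 - H 1 h + H 1 0"
proof -
  define G where "G u = H u (1 + h) - H u 1 - H u h + H u 0" for u
  define R where "R u = E u 1 + E u h" for u
  have step: "G u' - G u \<ge> - (u' - u) * (R u' - R u)" if "0 \<le> u" "u \<le> u'" for u u'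
  proof -
    have "(u' - u) * E u (1 + h) \<le> H u' (1 + h) - H u (1 + h)" "(u' - u) * E u 0 \<le> H u' 0 - H u 0"
      using Hu[of u u'] that h by auto
    moreover have "H u' 1 - H u 1 \<le> (u' - u) * E u' 1" "H u' h - H u h \<le> (u' - u) * E u' h"
      using Hu[of u' u 1] Hu[of u' u h] that h by (auto simp: algebra_simps)
    moreover have "(u' - u) * (E u 1 + E u h) \<le> (u' - u) * (E u (1 + h) + E u 0)"
      using convex_on_swap_le[OF conv h, of u] that by (intro mult_left_mono) auto
    ultimately show ?thesis by (simp add: G_def R_def algebra_simps)
  qed
  have "G 1 - G 0 \<ge> - (R 1 - R 0) / real N" if N: "0 < N" for N :: nat
  proof -
    have "G 1 - G 0 = (\<Sum>k<N. G (real (Suc k) / real N) - G (real k / real N))"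
      using N sum_lessThan_telescope[of "\<lambda>k. G (real k / real N)" N] by simp
    also have "\<dots> \<ge> (\<Sum>k<N. - (1 / real N) * (R (real (Suc k) / real N) - R (real k / real N)))"
    proof (rule sum_mono)
      fix k
      have "real (Suc k) / real N - real k / real N = 1 / real N"
        by (simp add: diff_divide_distrib[symmetric])
      then show "- (1 / real N) * (R (real (Suc k) / real N) - R (real k / real N))
          \<le> G (real (Suc k) / real N) - G (real k / real N)"
        using step[of "real k / real N" "real (Suc k) / real N"] by (simp add: divide_right_mono)
    qed
    also have "(\<Sum>k<N. - (1 / real N) * (R (real (Suc k) / real N) - R (real k / real N)))
        = - (R 1 - R 0) / real N"
      using N sum_lessThan_telescope[of "\<lambda>k. R (real k / real N)" N]
      by (simp only: sum_distrib_left[symmetric]) (simp add: diff_divide_distrib)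
    finally show ?thesis .
  qed
  moreover have "(\<lambda>N. - (R 1 - R 0) / real N) \<longlonglongrightarrow> 0" by (rule lim_const_over_n)
  ultimately have "0 \<le> G 1 - G 0"
    by (intro LIMSEQ_le_const2[where X = "\<lambda>N. - (R 1 - R 0) / real N"]) (auto intro!: exI[of _ 1])
  then show ?thesis by (simp add: G_def)
qed

section \<open>Traces of operator convex functions\<close>

lemma operator_convex_trace_prod:
  assumes f: "operator_convex f"
    and psd: "E \<in> psd_mats n" "X \<in> psd_mats n" "Y \<in> psd_mats n" and t: "0 \<le> t" "t \<le> 1"
  shows "trace_prod E (mat_fun f (complex_of_real t \<cdot>\<^sub>m X + complex_of_real (1 - t) \<cdot>\<^sub>m Y))
    \<le> t * trace_prod E (mat_fun f X) + (1 - t) * trace_prod E (mat_fun f Y)"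
proof -
  define P where "P = mat_fun f (complex_of_real t \<cdot>\<^sub>m X + complex_of_real (1 - t) \<cdot>\<^sub>m Y)"
  define Q where "Q = complex_of_real t \<cdot>\<^sub>m mat_fun f X + complex_of_real (1 - t) \<cdot>\<^sub>m mat_fun f Y"
  have P: "P \<in> carrier_mat n n" unfolding P_def
    using psd t by (intro mat_fun_carrier psd_add psd_smult) auto
  have Q: "Q \<in> carrier_mat n n" unfolding Q_def using psd by simp
  have "loewner_le P Q"
    using f psd t unfolding operator_convex_def P_def Q_def psd_mats_def by auto
  then have "Q - P \<in> psd_mats n" using P by (auto simp: loewner_le_def psd_mats_def minus_carrier_mat)
  from trace_prod_nonneg[OF psd(1) this] have "0 \<le> trace_prod E Q - trace_prod E P"
    using psd(1) P Q by (simp add: trace_prod_linear[of _ n] psd_matsD)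
  moreover have "trace_prod E Q = t * trace_prod E (mat_fun f X) + (1 - t) * trace_prod E (mat_fun f Y)"
    unfolding Q_def using psd psd_matsD[OF psd(1)]
    by (simp add: trace_prod_linear[of _ n] trace_prod_smult[of _ n] del: of_real_diff)
  ultimately show ?thesis by (simp add: P_def)
qed

text \<open>The case of \<open>1 \<times> 1\<close> matrices.\<close>

lemma operator_convex_imp_convex:
  assumes f: "operator_convex f"
  shows "convex_on {0..} f"
proof (rule convex_onI)
  fix t x y :: real assume *: "0 < t" "t < 1" "x \<in> {0..}" "y \<in> {0..}"
  let ?U = "1\<^sub>m 1 :: complex mat"
  have U: "?U \<in> carrier_mat 1 1" "unitary ?U" by (auto intro!: unitaryI[of _ 1] eq_matI)
  have psd: "unitary_conj_diag ?U (\<lambda>_. r) \<in> psd_mats 1" if "0 \<le> r" for r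
    using U(1) that by (intro unitary_conj_diag_psd) auto
  have val: "trace_prod (unitary_conj_diag ?U (\<lambda>_. 1)) (mat_fun f (unitary_conj_diag ?U (\<lambda>_. r))) = f r" for r
    unfolding mat_fun_unitary_conj_diag[OF U(2)] trace_prod_common_eigenbasis[OF U] by simp
  have "trace_prod (unitary_conj_diag ?U (\<lambda>_. 1)) (mat_fun f
      (complex_of_real (1 - t) \<cdot>\<^sub>m unitary_conj_diag ?U (\<lambda>_. x)
       + complex_of_real (1 - (1 - t)) \<cdot>\<^sub>m unitary_conj_diag ?U (\<lambda>_. y)))
    \<le> (1 - t) * f x + (1 - (1 - t)) * f y"
    using operator_convex_trace_prod[OF f psd psd psd, of 1 x y "1 - t"] * by (simp only: val) simp
  then show "f ((1 - t) *\<^sub>R x + t *\<^sub>R y) \<le> (1 - t) * f x + t * f y"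
    by (simp only: unitary_conj_diag_linear[OF U(1)] val) simp
qed simp

lemma operator_convex_line:
  assumes f: "operator_convex f" and psd: "E \<in> psd_mats n" "B \<in> psd_mats n" "C \<in> psd_mats n"
  shows "convex_on {0..} (\<lambda>s. trace_prod E (mat_fun f (B + complex_of_real s \<cdot>\<^sub>m C)))"
proof (rule convex_onI)
  fix t x y :: real assume *: "0 < t" "t < 1" "x \<in> {0..}" "y \<in> {0..}"
  have "B + complex_of_real ((1 - t) *\<^sub>R x + t *\<^sub>R y) \<cdot>\<^sub>m C =
      complex_of_real (1 - t) \<cdot>\<^sub>m (B + complex_of_real x \<cdot>\<^sub>m C)
      + complex_of_real (1 - (1 - t)) \<cdot>\<^sub>m (B + complex_of_real y \<cdot>\<^sub>m C)"
    using psd[THEN psd_matsD] by (intro eq_matI) (auto simp: algebra_simps)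
  then show "trace_prod E (mat_fun f (B + complex_of_real ((1 - t) *\<^sub>R x + t *\<^sub>R y) \<cdot>\<^sub>m C))
      \<le> (1 - t) * trace_prod E (mat_fun f (B + complex_of_real x \<cdot>\<^sub>m C))
        + t * trace_prod E (mat_fun f (B + complex_of_real y \<cdot>\<^sub>m C))"
    using operator_convex_trace_prod[OF f psd(1), of "B + complex_of_real x \<cdot>\<^sub>m C"
        "B + complex_of_real y \<cdot>\<^sub>m C" "1 - t"] * psd
    by (simp add: psd_add psd_smult del: of_real_diff)
qed simp

lemma zero_smult_add: "B \<in> carrier_mat n n \<Longrightarrow> C \<in> carrier_mat n n \<Longrightarrow> B + complex_of_real 0 \<cdot>\<^sub>m C = B"
  by (intro eq_matI) auto

lemma one_smult: "complex_of_real 1 \<cdot>\<^sub>m C = C"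
  by (intro eq_matI) auto

text \<open>With \<open>C\<close> and \<open>E\<close> the matrices with eigenvalues \<open>c\<close> and \<open>e\<close>, the function
\<open>t \<mapsto> Tr (E f(B + t C))\<close> is convex on the half-line. Since \<open>B + t C\<close> is the midpoint of \<open>2 B\<close> and \<open>2 t C\<close>,
and \<open>E f(2 t C) = 0\<close> because \<open>E C = 0\<close> and \<open>f 0 = 0\<close>, it is bounded above by \<open>Tr (E f(2 B)) / 2\<close>.
A convex function on a half-line that is bounded above cannot increase.\<close>

lemma trace_orthogonal_perturbation_le:
  assumes f: "operator_convex f" "f 0 = 0" and B: "B \<in> psd_mats n"
    and U: "U \<in> carrier_mat n n" "unitary U"
    and ce: "\<And>i. i < n \<Longrightarrow> 0 \<le> c i" "\<And>i. i < n \<Longrightarrow> 0 \<le> e i" "\<And>i. i < n \<Longrightarrow> e i = 0 \<or> c i = 0"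
  shows "trace_prod (unitary_conj_diag U e) (mat_fun f (B + unitary_conj_diag U c))
    \<le> trace_prod (unitary_conj_diag U e) (mat_fun f B)"
proof -
  define E C where "E = unitary_conj_diag U e" and "C = unitary_conj_diag U c"
  have psd: "E \<in> psd_mats n" "C \<in> psd_mats n"
    using U ce by (auto simp: E_def C_def intro!: unitary_conj_diag_psd)
  define \<phi> where "\<phi> t = trace_prod E (mat_fun f (B + complex_of_real t \<cdot>\<^sub>m C))" for t
  have "\<phi> t \<le> 1/2 * trace_prod E (mat_fun f (complex_of_real 2 \<cdot>\<^sub>m B))" if t: "0 \<le> t" for t
  proof -
    have "B + complex_of_real t \<cdot>\<^sub>m C = complex_of_real (1/2) \<cdot>\<^sub>m (complex_of_real 2 \<cdot>\<^sub>m B)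
        + complex_of_real (1 - 1/2) \<cdot>\<^sub>m (complex_of_real (2 * t) \<cdot>\<^sub>m C)"
      using B psd by (intro eq_matI) (auto dest!: psd_matsD)
    then have "\<phi> t \<le> 1/2 * trace_prod E (mat_fun f (complex_of_real 2 \<cdot>\<^sub>m B))
        + (1 - 1/2) * trace_prod E (mat_fun f (complex_of_real (2 * t) \<cdot>\<^sub>m C))"
      unfolding \<phi>_def
      using operator_convex_trace_prod[OF f(1) psd(1) psd_smult[OF B] psd_smult[OF psd(2)], of 2 "2 * t" "1/2"] t
      by simp
    also have "trace_prod E (mat_fun f (complex_of_real (2 * t) \<cdot>\<^sub>m C)) = (\<Sum>i<n. e i * f (2 * t * c i))"
      unfolding E_def C_def unitary_conj_diag_linear[OF U(1)]
      by (simp add: mat_fun_unitary_conj_diag[OF U(2)] trace_prod_common_eigenbasis[OF U])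
    also have "\<dots> = 0" using ce(3) f(2) by (intro sum.neutral) fastforce
    finally show ?thesis by simp
  qed
  moreover have "convex_on {0..} \<phi>"
    unfolding \<phi>_def by (rule operator_convex_line[OF f(1) psd(1) B psd(2)])
  ultimately have "\<phi> 1 \<le> \<phi> 0" by (rule convex_on_bounded_imp_le[rotated])
  moreover have "\<phi> 1 = trace_prod E (mat_fun f (B + C))" "\<phi> 0 = trace_prod E (mat_fun f B)"
    by (simp_all only: \<phi>_def one_smult zero_smult_add[OF psd_matsD[OF B] psd_matsD[OF psd(2)]])
  ultimately show ?thesis by (simp add: E_def C_def)
qed

text \<open>The heuristic reason is that \<open>\<psi> u = Tr (C (f(u B + C) - f(u B)))\<close> is nondecreasing in \<open>u\<close>, so that
\<open>\<psi> 1 \<ge> \<psi> 0\<close>. Indeed, as \<open>Tr (C Df(X)[B]) = Tr (B Df(X)[C])\<close>, the derivative of \<open>\<psi>\<close> is the increase of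
\<open>Tr (B Df(u B + s C)[C])\<close> between \<open>s = 0\<close> and \<open>s = 1\<close>, and \<open>s \<mapsto> Tr (B f(u B + s C))\<close> is convex.

The symmetry of \<open>Df\<close> comes from the potential \<open>H u s = Tr F(u B + s C)\<close>, with \<open>F\<close> an antiderivative of \<open>f\<close>:
the partial derivatives of \<open>H\<close> are \<open>E u s = Tr (B f(u B + s C))\<close> and \<open>D u s = Tr (C f(u B + s C))\<close>. The proof
therefore works with mixed differences of \<open>H\<close>: in the direction \<open>u\<close> over the whole interval from \<open>0\<close> to \<open>1\<close>,
and in the direction \<open>s\<close> over a step \<open>h\<close>, which tends to \<open>0\<close> at the end.\<close>

lemma trace_increment_ge:
  assumes f: "operator_convex f" "f 0 = 0" "\<And>x. 0 \<le> x \<Longrightarrow> 0 \<le> f x"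
    and B: "B \<in> psd_mats n" and C: "C \<in> psd_mats n"
  shows "trace_prod C (mat_fun f C) \<le> trace_prod C (mat_fun f (B + C)) - trace_prod C (mat_fun f B)"
proof -
  note conv = operator_convex_imp_convex[OF f(1)]
  obtain F where F: "\<And>x y. 0 \<le> x \<Longrightarrow> 0 \<le> y \<Longrightarrow> f x * (y - x) \<le> F y - F x"
    using mono_subgradient_exists[OF convex_nonneg_imp_mono[OF conv f(3) f(2)]] by blast
  define Z where "Z u s = complex_of_real u \<cdot>\<^sub>m B + complex_of_real s \<cdot>\<^sub>m C" for u s
  define H where "H u s = Re (trace (mat_fun F (Z u s)))" for u s
  define E where "E u s = trace_prod B (mat_fun f (Z u s))" for u s
  define D where "D u s = trace_prod C (mat_fun f (Z u s))" for u s
  note BC = psd_matsD[OF B] psd_matsD[OF C]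
  have Z: "Z u s \<in> psd_mats n" if "0 \<le> u" "0 \<le> s" for u s
    unfolding Z_def using B C that by (intro psd_add psd_smult)
  have Hu: "(u' - u) * E u s \<le> H u' s - H u s" if "0 \<le> u" "0 \<le> u'" "0 \<le> s" for u u' s
    unfolding E_def H_def
  proof (rule Klein_inequality_along_line[OF F])
    show "Z u' s - Z u s = complex_of_real (u' - u) \<cdot>\<^sub>m B"
      using BC by (intro eq_matI) (auto simp: Z_def algebra_simps)
  qed (use Z BC that in auto)
  have Hs: "(s' - s) * D u s \<le> H u s' - H u s" if "0 \<le> u" "0 \<le> s" "0 \<le> s'" for u s s'
    unfolding D_def H_def
  proof (rule Klein_inequality_along_line[OF F])
    show "Z u s' - Z u s = complex_of_real (s' - s) \<cdot>\<^sub>m C"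
      using BC by (intro eq_matI) (auto simp: Z_def algebra_simps)
  qed (use Z BC that in auto)
  have convE: "convex_on {0..} (E u)" if "0 \<le> u" for u
    unfolding E_def Z_def using B C that by (intro operator_convex_line[OF f(1)] psd_smult)
  have convD: "convex_on {0..} (D 1)"
    unfolding D_def Z_def using B C by (intro operator_convex_line[OF f(1)] psd_smult) auto
  obtain V c where V: "V \<in> carrier_mat n n" "unitary V" "C = unitary_conj_diag V c"
    "\<And>i. i < n \<Longrightarrow> 0 \<le> c i" using psd_spectral[OF C] by metis
  have Z0: "Z 0 s = complex_of_real s \<cdot>\<^sub>m C" for s
    using BC by (intro eq_matI) (auto simp: Z_def)
  have D0: "D 0 s = (\<Sum>i<n. c i * f (s * c i))" for s
    unfolding D_def Z0 unfolding V(3) unitary_conj_diag_linear[OF V(1)]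
    by (simp add: mat_fun_unitary_conj_diag[OF V(2)] trace_prod_common_eigenbasis[OF V(1,2)])
  have D0h: "D 0 h \<le> h * D 0 1" if "0 \<le> h" "h \<le> 1" for h
  proof -
    have "D 0 h \<le> (\<Sum>i<n. c i * (h * f (c i)))"
      unfolding D0 using V(4) that by (intro sum_mono mult_left_mono convex_scale_le[OF conv f(2)]) auto
    also have "\<dots> = h * D 0 1" by (simp add: D0 sum_distrib_left mult.left_commute)
    finally show ?thesis .
  qed
  have key: "D 0 1 - (D 1 1 - D 1 0) \<le> h * (D 0 1 - D 1 1 + D 1 2)" if h: "0 < h" "h \<le> 1" for h
  proof -
    have "h * (D 0 1 - D 0 h) \<le> H 0 (1 + h) - H 0 1 - H 0 h + H 0 0"
      using Hs[of 0 1 "1 + h"] Hs[of 0 h 0] h by (simp add: algebra_simps)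
    also have "\<dots> \<le> H 1 (1 + h) - H 1 1 - H 1 h + H 1 0"
      by (rule mixed_difference_le[OF Hu convE h(1)])
    also have "\<dots> \<le> h * (D 1 (1 + h) - D 1 0)"
      using Hs[of 1 "1 + h" 1] Hs[of 1 0 h] h by (simp add: algebra_simps)
    finally have "D 0 1 - D 0 h \<le> D 1 (1 + h) - D 1 0" using h by simp
    \<comment> \<open>Convexity on \<open>[1, 2]\<close> gives the upper semicontinuity of \<open>D 1\<close> at \<open>1\<close> with an explicit bound.\<close>
    moreover have "D 1 (1 + h) \<le> (1 - h) * D 1 1 + h * D 1 2"
      using convex_onD[OF convD, of h 1 2] h by (simp add: algebra_simps)
    ultimately show ?thesis using D0h[of h] h by (simp add: algebra_simps)
  qed
  have "D 0 1 - (D 1 1 - D 1 0) \<le> 0"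
  proof (rule tendsto_lowerbound)
    show "((\<lambda>h. h * (D 0 1 - D 1 1 + D 1 2)) \<longlongrightarrow> 0) (at_right 0)"
      by (auto intro!: tendsto_eq_intros)
    show "\<forall>\<^sub>F h in at_right 0. D 0 1 - (D 1 1 - D 1 0) \<le> h * (D 0 1 - D 1 1 + D 1 2)"
      using eventually_at_right_real[of 0 1, simplified] by eventually_elim (auto intro!: key)
  qed simp
  moreover have "Z 0 1 = C" "Z 1 1 = B + C" "Z 1 0 = B"
    using BC by (auto simp: Z_def intro!: eq_matI)
  ultimately show ?thesis by (simp add: D_def)
qed

theorem theorem2p3:
  fixes f :: "real \<Rightarrow> real" and A B :: "complex mat" and n :: nat
  assumes "\<And>x. 0 \<le> x \<Longrightarrow> 0 \<le> f x"
    and "operator_convex f"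
    and "f 0 = 0"
    and "A \<in> carrier_mat n n" and "B \<in> carrier_mat n n"
    and "psd A" and "psd B"
  shows "trace ((A - B) * (mat_fun f A - mat_fun f B))
           \<ge> trace (mat_abs (A - B) * mat_fun f (mat_abs (A - B)))"
proof -
  note f = assms(2,3)
  have A: "A \<in> psd_mats n" and B: "B \<in> psd_mats n" using assms by (auto simp: psd_mats_def)
  note AB = assms(4,5)
  have hAB: "hermitian A" "hermitian B" using assms(6,7) by (auto simp: psd_def)
  have Dc: "A - B \<in> carrier_mat n n" using AB by (simp add: minus_carrier_mat)
  obtain U d where U: "U \<in> carrier_mat n n" "unitary U" and D: "A - B = unitary_conj_diag U d"
    using spectral_theorem[OF hermitian_minus[OF AB hAB] Dc] by blast
  define p m where "p i = max (d i) 0" and "m i = max (- d i) 0" for i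
  define P M where "P = unitary_conj_diag U p" and "M = unitary_conj_diag U m"
  have P: "P \<in> psd_mats n" and M: "M \<in> psd_mats n"
    using U by (auto simp: P_def M_def p_def m_def intro!: unitary_conj_diag_psd)
  have PM: "A - B = P - M"
    unfolding D P_def M_def unitary_conj_diag_linear[OF U(1)]
    by (rule unitary_conj_diag_cong[OF U(1)]) (auto simp: p_def m_def)
  define R where "R = B + P"
  have R: "R \<in> psd_mats n" unfolding R_def by (rule psd_add[OF B P])
  have R': "R = A + M"
  proof (rule eq_matI)
    fix i j assume ij: "i < dim_row (A + M)" "j < dim_col (A + M)"
    have "(A - B) $$ (i, j) = (P - M) $$ (i, j)" by (simp add: PM)
    then show "R $$ (i, j) = (A + M) $$ (i, j)"
      using ij AB psd_matsD[OF P] psd_matsD[OF M] by (auto simp: R_def algebra_simps)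
  qed (use AB psd_matsD[OF P] psd_matsD[OF M] in \<open>auto simp: R_def\<close>)
  note car = psd_matsD[OF P] psd_matsD[OF M] mat_fun_carrier[OF A] mat_fun_carrier[OF B] mat_fun_carrier[OF R]
  let ?t = "\<lambda>X Y. trace_prod X (mat_fun f Y)"
  \<comment> \<open>Expanding \<open>A - B = P - M\<close> and \<open>f(A) - f(B) = (f(R) - f(B)) - (f(R) - f(A))\<close> gives four traces.
    The two where the weight is the increment have the required lower bound; the other two have the
    weight orthogonal to the increment and the right sign.\<close>
  have pp: "?t P P \<le> ?t P R - ?t P B"
    unfolding R_def by (rule trace_increment_ge[OF f assms(1) B P])
  have mm: "?t M M \<le> ?t M R - ?t M A"
    unfolding R' by (rule trace_increment_ge[OF f assms(1) A M])
  have mp: "?t M R \<le> ?t M B"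
    unfolding R_def M_def P_def
    by (rule trace_orthogonal_perturbation_le[OF f B U]) (auto simp: p_def m_def)
  have pm: "?t P R \<le> ?t P A"
    unfolding R' M_def P_def
    by (rule trace_orthogonal_perturbation_le[OF f A U]) (auto simp: p_def m_def)
  have "?t P P + ?t M M \<le> trace_prod (A - B) (mat_fun f A - mat_fun f B)"
    using pp mm mp pm car by (simp add: PM trace_prod_linear[of _ n] minus_carrier_mat)
  have absD: "mat_abs (A - B) = unitary_conj_diag U (\<lambda>i. \<bar>d i\<bar>)"
  proof -
    have "mat_adjoint (A - B) * (A - B) = unitary_conj_diag U (\<lambda>i. d i * d i)"
      using hermitian_unitary_conj_diag[OF U(1), of d]
      by (simp add: D hermitian_def unitary_conj_diag_mult[OF U])
    then show ?thesis by (simp add: mat_abs_def mat_fun_unitary_conj_diag[OF U(2)])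
  qed
  have "trace (mat_abs (A - B) * mat_fun f (mat_abs (A - B))) = complex_of_real (\<Sum>i<n. \<bar>d i\<bar> * f \<bar>d i\<bar>)"
    by (simp add: absD mat_fun_unitary_conj_diag[OF U(2)] unitary_conj_diag_mult[OF U] trace_unitary_conj_diag[OF U])
  also have "(\<Sum>i<n. \<bar>d i\<bar> * f \<bar>d i\<bar>) = ?t P P + ?t M M"
    unfolding P_def M_def mat_fun_unitary_conj_diag[OF U(2)] trace_prod_common_eigenbasis[OF U] sum.distrib[symmetric]
    by (rule sum.cong) (auto simp: p_def m_def f(2) max_def)
  also have "complex_of_real (?t P P + ?t M M) \<le> complex_of_real (trace_prod (A - B) (mat_fun f A - mat_fun f B))"
    using \<open>?t P P + ?t M M \<le> _\<close> by (simp add: less_eq_complex_def)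
  also have "\<dots> = trace ((A - B) * (mat_fun f A - mat_fun f B))"
    using Dc car AB hAB by (intro trace_hermitian_mult_real[symmetric, of _ n] hermitian_minus mat_fun_hermitian)
      (auto simp: minus_carrier_mat)
  finally show ?thesis .
qed

end
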